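(* Let $C$ be a code in $\Gamma=H(m,q)$ with minimum distance $\delta\geq 3$, and let $x$ be an automorphism of $\Gamma$ fixing setwise the set $\Gamma_1(C)$ of neighbours of $C$. Then at least one of the following holds: (1) $x$ fixes $C$ setwise; (2) $\delta=4$, $q=2$ and $m$ is even; (3) $\delta=3$ and $m(q-1)$ is even. Moreover, for each even integer $m\geq 4$ there exist a code $C\subset H(m,2)$ with minimum distance $\delta=4$ and a subgroup $X$ of the automorphism group of $H(m,2)$ such that $C$ is $X$-neighbour transitive and $X$ does not fix $C$ setwise.
   Context: For positive integers $m,q$, the Hamming graph $\Gamma=H(m,q)$ has as vertices all $m$-tuples with entries from a fixed set $Q$ of size $q$; two vertices are adjacent if and only if they differ in exactly one entry. $d(\alpha,\beta)$ is the number of entries in which the vertices $\alpha,\beta$ differ. An automorphism of $\Gamma$ is a graph automorphism. A code in $H(m,q)$ is a subset $C$ of the vertex set. Its minimum distance is $\delta=\min\{d(\alpha,\beta) : \alpha,\beta\in C,\ \alpha\neq\beta\}$; speaking of the minimum distance presupposes that $C$ has at least two elements. For a vertex $\beta$, $\Gamma_1(\beta)=\{\gamma : d(\beta,\gamma)=1\}$. The set of neighbours of $C$ is $\Gamma_1(C)=\left(\bigcup_{\alpha\in C}\Gamma_1(\alpha)\right)\setminus C$. For a subgroup $X$ of the automorphism group of $H(m,q)$, the code $C$ is $X$-neighbour transitive if $X$ fixes $\Gamma_1(C)$ setwise and acts transitively on $\Gamma_1(C)$. *)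

theory Defs
  imports
    "HOL-Library.FuncSet"
    "HOL-Algebra.Group_Action"
    "Graph_Theory.Pair_Digraph"
begin

text \<open>
  An \<open>m\<close>-tuple over \<open>Q\<close> is an extensional function on \<open>{..<m}\<close> with values in \<open>Q\<close>.
\<close>

definition tuples :: "nat \<Rightarrow> 'a set \<Rightarrow> (nat \<Rightarrow> 'a) set" where
  "tuples m Q = {..<m} \<rightarrow>\<^sub>E Q"

definition hdist :: "nat \<Rightarrow> (nat \<Rightarrow> 'a) \<Rightarrow> (nat \<Rightarrow> 'a) \<Rightarrow> nat" where
  "hdist m \<alpha> \<beta> = card {i. i < m \<and> \<alpha> i \<noteq> \<beta> i}"

text \<open>
  An undirected graph is a symmetric, loop-free pair digraph.
\<close>

definition hamming_graph :: "nat \<Rightarrow> 'a set \<Rightarrow> (nat \<Rightarrow> 'a) pair_pre_digraph" where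
  "hamming_graph m Q =
    \<lparr> pverts = tuples m Q,
      parcs = {(\<alpha>, \<beta>). \<alpha> \<in> tuples m Q \<and> \<beta> \<in> tuples m Q \<and> hdist m \<alpha> \<beta> = 1} \<rparr>"

text \<open>
  As for \<open>BijGroup\<close>, automorphisms are extensional on the vertex set, so that each
  automorphism is represented by exactly one function.
\<close>

definition graph_aut :: "'v pair_pre_digraph \<Rightarrow> ('v \<Rightarrow> 'v) set" where
  "graph_aut G = {f \<in> Bij (pverts G).
     \<forall>u \<in> pverts G. \<forall>v \<in> pverts G. (u, v) \<in> parcs G \<longleftrightarrow> (f u, f v) \<in> parcs G}"

definition graph_aut_group :: "'v pair_pre_digraph \<Rightarrow> ('v \<Rightarrow> 'v) monoid" where
  "graph_aut_group G = BijGroup (pverts G) \<lparr>carrier := graph_aut G\<rparr>"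

text \<open>
  Only meaningful if \<open>C\<close> has at least two elements: otherwise this is \<open>Min {}\<close>.
\<close>

definition min_distance :: "nat \<Rightarrow> (nat \<Rightarrow> 'a) set \<Rightarrow> nat" where
  "min_distance m C = Min {hdist m \<alpha> \<beta> | \<alpha> \<beta>. \<alpha> \<in> C \<and> \<beta> \<in> C \<and> \<alpha> \<noteq> \<beta>}"

definition vertex_neighbours :: "nat \<Rightarrow> 'a set \<Rightarrow> (nat \<Rightarrow> 'a) \<Rightarrow> (nat \<Rightarrow> 'a) set" where
  "vertex_neighbours m Q \<beta> = {\<gamma> \<in> pverts (hamming_graph m Q). hdist m \<beta> \<gamma> = 1}"

definition code_neighbours :: "nat \<Rightarrow> 'a set \<Rightarrow> (nat \<Rightarrow> 'a) set \<Rightarrow> (nat \<Rightarrow> 'a) set" where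
  "code_neighbours m Q C = (\<Union>\<alpha>\<in>C. vertex_neighbours m Q \<alpha>) - C"

definition fixes_setwise :: "('v \<Rightarrow> 'v) \<Rightarrow> 'v set \<Rightarrow> bool" where
  "fixes_setwise x S \<longleftrightarrow> x ` S = S"

text \<open>
  \<open>X\<close> is meant to be a subgroup of \<open>graph_aut_group (hamming_graph m Q)\<close>; it acts on the set
  of neighbours by restriction of functions.
\<close>

definition neighbour_transitive ::
  "nat \<Rightarrow> 'a set \<Rightarrow> ((nat \<Rightarrow> 'a) \<Rightarrow> (nat \<Rightarrow> 'a)) set \<Rightarrow> (nat \<Rightarrow> 'a) set \<Rightarrow> bool" where
  "neighbour_transitive m Q X C \<longleftrightarrow>
    (\<forall>x\<in>X. fixes_setwise x (code_neighbours m Q C)) \<and>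
    transitive_action (graph_aut_group (hamming_graph m Q) \<lparr>carrier := X\<rparr>)
      (code_neighbours m Q C) (\<lambda>x. restrict x (code_neighbours m Q C))"

end

theory Submission
  imports Defs "HOL-Combinatorics.Transposition"
begin

text \<open>
  If \<open>x\<close> moves a codeword to a vertex \<open>v\<close> outside \<open>C\<close>, then every neighbour of \<open>v\<close> lies in
  \<open>\<Gamma>\<^sub>1(C)\<close>, while \<open>v\<close> does not; so every neighbour of \<open>v\<close> is adjacent to a unique codeword, which is at
  distance 2 from \<open>v\<close>. Such a codeword has exactly two common neighbours with \<open>v\<close>, whence
  \<open>m(q - 1)\<close> is even. If \<open>q > 2\<close>, two neighbours of \<open>v\<close> that differ from it in the same entry give
  codewords at distance at most 3; if \<open>q = 2\<close>, there are still two codewords at distance at most 4.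

  For \<open>m = 2k\<close>, pair up the entries and consider the words that are constant on every pair. Those
  with an odd number of pairs \<open>bb\<close> have the same neighbours as those with an even number: the words
  with exactly one mixed pair. The setwise stabilizer of this set is transitive on it and contains
  the map that swaps the two letters in a single pair, which exchanges the two parities.
\<close>

section \<open>Hamming distance and neighbourhoods of vertices\<close>

lemma pverts_hamming_graph [simp]: "pverts (hamming_graph m Q) = tuples m Q"
  by (simp add: hamming_graph_def)

lemma parcs_hamming_graph [simp]:
  "(\<alpha>, \<beta>) \<in> parcs (hamming_graph m Q) \<longleftrightarrow>
    \<alpha> \<in> tuples m Q \<and> \<beta> \<in> tuples m Q \<and> hdist m \<alpha> \<beta> = 1"
  by (simp add: hamming_graph_def)

lemma tuples_eqI:
  assumes "\<alpha> \<in> tuples m Q" "\<beta> \<in> tuples m Q" "\<And>i. i < m \<Longrightarrow> \<alpha> i = \<beta> i"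
  shows "\<alpha> = \<beta>"
  using assms unfolding tuples_def by (metis PiE_ext lessThan_iff)

lemma tuples_mem: "\<alpha> \<in> tuples m Q \<Longrightarrow> i < m \<Longrightarrow> \<alpha> i \<in> Q"
  unfolding tuples_def by auto

lemma tuples_fun_upd:
  "\<alpha> \<in> tuples m Q \<Longrightarrow> i < m \<Longrightarrow> a \<in> Q \<Longrightarrow> \<alpha>(i := a) \<in> tuples m Q"
  unfolding tuples_def by (auto simp: PiE_iff extensional_def)

lemma finite_tuples: "finite Q \<Longrightarrow> finite (tuples m Q)"
  unfolding tuples_def by (simp add: finite_PiE)

lemma hdist_commute: "hdist m \<alpha> \<beta> = hdist m \<beta> \<alpha>"
  unfolding hdist_def by (metis (no_types, lifting))

lemma hdist_le_card:
  assumes "\<And>i. i < m \<Longrightarrow> \<alpha> i \<noteq> \<beta> i \<Longrightarrow> i \<in> S" "finite S"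
  shows "hdist m \<alpha> \<beta> \<le> card S"
  unfolding hdist_def using assms by (intro card_mono) auto

lemma hdist_ge_card:
  assumes "\<And>i. i \<in> S \<Longrightarrow> i < m \<and> \<alpha> i \<noteq> \<beta> i"
  shows "card S \<le> hdist m \<alpha> \<beta>"
  unfolding hdist_def using assms by (intro card_mono) auto

lemma hdist_triangle: "hdist m \<alpha> \<gamma> \<le> hdist m \<alpha> \<beta> + hdist m \<beta> \<gamma>"
proof -
  have "hdist m \<alpha> \<gamma> \<le> card ({i. i < m \<and> \<alpha> i \<noteq> \<beta> i} \<union> {i. i < m \<and> \<beta> i \<noteq> \<gamma> i})"
    by (rule hdist_le_card) auto
  also have "\<dots> \<le> hdist m \<alpha> \<beta> + hdist m \<beta> \<gamma>"
    unfolding hdist_def by (rule card_Un_le)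
  finally show ?thesis .
qed

lemma hdist_eq_0_iff:
  assumes "\<alpha> \<in> tuples m Q" "\<beta> \<in> tuples m Q"
  shows "hdist m \<alpha> \<beta> = 0 \<longleftrightarrow> \<alpha> = \<beta>"
proof
  assume "hdist m \<alpha> \<beta> = 0"
  then show "\<alpha> = \<beta>"
    by (intro tuples_eqI[OF assms]) (auto simp: hdist_def)
qed (simp add: hdist_def)

lemma hdist_fun_upd: "i < m \<Longrightarrow> \<alpha> i \<noteq> a \<Longrightarrow> hdist m \<alpha> (\<alpha>(i := a)) = 1"
proof -
  assume "i < m" "\<alpha> i \<noteq> a"
  then have "{j. j < m \<and> \<alpha> j \<noteq> (\<alpha>(i := a)) j} = {i}" by auto
  then show ?thesis unfolding hdist_def by simp
qed

lemma hdist_1E: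
  assumes "hdist m \<alpha> \<beta> = 1"
  obtains i where "i < m" "\<alpha> i \<noteq> \<beta> i" "\<And>j. j < m \<Longrightarrow> j \<noteq> i \<Longrightarrow> \<alpha> j = \<beta> j"
proof -
  obtain i where "{i. i < m \<and> \<alpha> i \<noteq> \<beta> i} = {i}"
    using assms unfolding hdist_def by (rule card_1_singletonE)
  then show thesis using that[of i] by blast
qed

lemma vertex_neighbours_iff:
  "\<gamma> \<in> vertex_neighbours m Q \<alpha> \<longleftrightarrow> \<gamma> \<in> tuples m Q \<and> hdist m \<alpha> \<gamma> = 1"
  by (simp add: vertex_neighbours_def)

text \<open>Indexing the neighbours by the changed entry and its new letter prepares the count of
  the valency m(q - 1).\<close>

lemma vertex_neighbours_eq:
  assumes "\<alpha> \<in> tuples m Q"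
  shows "vertex_neighbours m Q \<alpha> = (\<lambda>(i, a). \<alpha>(i := a)) ` (SIGMA i:{..<m}. Q - {\<alpha> i})"
    (is "_ = ?h ` ?S")
proof (intro equalityI subsetI)
  fix \<gamma> assume "\<gamma> \<in> vertex_neighbours m Q \<alpha>"
  then have \<gamma>: "\<gamma> \<in> tuples m Q" "hdist m \<alpha> \<gamma> = 1" by (auto simp: vertex_neighbours_iff)
  obtain i where i: "i < m" "\<alpha> i \<noteq> \<gamma> i" "\<And>j. j < m \<Longrightarrow> j \<noteq> i \<Longrightarrow> \<alpha> j = \<gamma> j"
    using hdist_1E[OF \<gamma>(2)] by metis
  have "\<gamma> i \<in> Q" using \<gamma>(1) i(1) by (rule tuples_mem)
  moreover have "\<gamma> = \<alpha>(i := \<gamma> i)"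
    using i \<open>\<gamma> i \<in> Q\<close> by (intro tuples_eqI[OF \<gamma>(1) tuples_fun_upd[OF assms]]) auto
  ultimately show "\<gamma> \<in> ?h ` ?S"
    using i by (intro image_eqI[where x = "(i, \<gamma> i)"]) auto
next
  fix \<gamma> assume "\<gamma> \<in> ?h ` ?S"
  then show "\<gamma> \<in> vertex_neighbours m Q \<alpha>"
    using assms by (auto simp: vertex_neighbours_iff tuples_fun_upd hdist_fun_upd[unfolded One_nat_def])
qed

lemma card_vertex_neighbours:
  assumes "\<alpha> \<in> tuples m Q" "finite Q"
  shows "card (vertex_neighbours m Q \<alpha>) = m * (card Q - 1)"
proof -
  have "inj_on (\<lambda>(i, a). \<alpha>(i := a)) (SIGMA i:{..<m}. Q - {\<alpha> i})"
    by (auto simp: inj_on_def fun_eq_iff split: if_splits)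
  then show ?thesis
    using assms by (simp add: vertex_neighbours_eq card_image tuples_mem)
qed

text \<open>A common neighbour takes the letter of \<beta> in one of the two differing entries and
  that of \<alpha> in the other.\<close>

lemma card_common_neighbours:
  assumes \<alpha>: "\<alpha> \<in> tuples m Q" and \<beta>: "\<beta> \<in> tuples m Q" and "hdist m \<alpha> \<beta> = 2"
  shows "card (vertex_neighbours m Q \<alpha> \<inter> vertex_neighbours m Q \<beta>) = 2"
proof -
  obtain i j where ij: "{i. i < m \<and> \<alpha> i \<noteq> \<beta> i} = {i, j}" "i \<noteq> j"
    using assms(3) unfolding hdist_def by (meson card_2_iff)
  then have ij': "i < m" "j < m" "\<alpha> i \<noteq> \<beta> i" "\<alpha> j \<noteq> \<beta> j"
    and same: "\<And>l. l < m \<Longrightarrow> l \<noteq> i \<Longrightarrow> l \<noteq> j \<Longrightarrow> \<alpha> l = \<beta> l" by blast+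
  have "vertex_neighbours m Q \<alpha> \<inter> vertex_neighbours m Q \<beta> = {\<alpha>(i := \<beta> i), \<alpha>(j := \<beta> j)}"
  proof (intro equalityI subsetI)
    fix \<gamma> assume "\<gamma> \<in> vertex_neighbours m Q \<alpha> \<inter> vertex_neighbours m Q \<beta>"
    then have \<gamma>: "\<gamma> \<in> tuples m Q" "hdist m \<alpha> \<gamma> = 1" "hdist m \<beta> \<gamma> = 1"
      by (auto simp: vertex_neighbours_iff)
    obtain k where k: "k < m" "\<alpha> k \<noteq> \<gamma> k" "\<And>l. l < m \<Longrightarrow> l \<noteq> k \<Longrightarrow> \<alpha> l = \<gamma> l"
      using hdist_1E[OF \<gamma>(2)] by metis
    obtain k' where k': "k' < m" "\<And>l. l < m \<Longrightarrow> l \<noteq> k' \<Longrightarrow> \<beta> l = \<gamma> l"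
      using hdist_1E[OF \<gamma>(3)] by metis
    \<comment> \<open>At \<open>i\<close> and at \<open>j\<close> the word \<gamma> cannot agree
      with both \<alpha> and \<beta>, so each of these entries is \<open>k\<close> or
      \<open>k'\<close>.\<close>
    have "k = i \<and> k' = j \<or> k = j \<and> k' = i"
      using ij(2) ij' k(3) k'(2) by metis
    then have "\<gamma> = \<alpha>(k := \<beta> k)"
      using k k' ij' ij(2) \<beta>
      by (intro tuples_eqI[OF \<gamma>(1) tuples_fun_upd[OF \<alpha>]]) (auto simp: tuples_mem)
    then show "\<gamma> \<in> {\<alpha>(i := \<beta> i), \<alpha>(j := \<beta> j)}"
      using \<open>k = i \<and> k' = j \<or> k = j \<and> k' = i\<close> by auto
  next
    note upd = tuples_fun_upd[OF \<alpha> _ tuples_mem[OF \<beta>]] tuples_fun_upd[OF \<beta> _ tuples_mem[OF \<alpha>]]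
    \<comment> \<open>The same vertex is reached from \<beta> by changing the other entry; this puts
      it at distance 1 from both.\<close>
    have swap_i: "\<alpha>(i := \<beta> i) = \<beta>(j := \<alpha> j)"
      by (rule tuples_eqI[OF upd]) (use ij(2) ij' same in auto)
    have swap_j: "\<alpha>(j := \<beta> j) = \<beta>(i := \<alpha> i)"
      by (rule tuples_eqI[OF upd]) (use ij(2) ij' same in auto)
    fix \<gamma> assume "\<gamma> \<in> {\<alpha>(i := \<beta> i), \<alpha>(j := \<beta> j)}"
    then show "\<gamma> \<in> vertex_neighbours m Q \<alpha> \<inter> vertex_neighbours m Q \<beta>"
    proof (elim insertE emptyE)
      assume \<gamma>: "\<gamma> = \<alpha>(i := \<beta> i)"
      then have "hdist m \<alpha> \<gamma> = 1" "hdist m \<beta> \<gamma> = 1"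
        using hdist_fun_upd[of i m \<alpha> "\<beta> i"] hdist_fun_upd[of j m \<beta> "\<alpha> j"] ij'
        unfolding \<gamma> swap_i[symmetric] by metis+
      then show ?thesis
        using \<gamma> upd(1)[of i i] ij' by (simp add: vertex_neighbours_iff)
    next
      assume \<gamma>: "\<gamma> = \<alpha>(j := \<beta> j)"
      then have "hdist m \<alpha> \<gamma> = 1" "hdist m \<beta> \<gamma> = 1"
        using hdist_fun_upd[of j m \<alpha> "\<beta> j"] hdist_fun_upd[of i m \<beta> "\<alpha> i"] ij'
        unfolding \<gamma> swap_j[symmetric] by metis+
      then show ?thesis
        using \<gamma> upd(1)[of j j] ij' by (simp add: vertex_neighbours_iff)
    qed
  qed
  moreover have "\<alpha>(i := \<beta> i) \<noteq> \<alpha>(j := \<beta> j)"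
    using ij' ij(2) by (auto simp: fun_eq_iff)
  ultimately show ?thesis by simp
qed

section \<open>Codes with minimum distance at least 3\<close>

lemma finite_distances:
  assumes "finite C"
  shows "finite {hdist m \<alpha> \<beta> | \<alpha> \<beta>. \<alpha> \<in> C \<and> \<beta> \<in> C \<and> \<alpha> \<noteq> \<beta>}"
  by (rule finite_subset[OF _ finite_imageI[OF finite_cartesian_product[OF assms assms],
        of "\<lambda>(\<alpha>, \<beta>). hdist m \<alpha> \<beta>"]]) auto

lemma min_distance_le:
  assumes "finite C" "\<alpha> \<in> C" "\<beta> \<in> C" "\<alpha> \<noteq> \<beta>"
  shows "min_distance m C \<le> hdist m \<alpha> \<beta>"
  unfolding min_distance_def using assms by (intro Min_le finite_distances) auto

text \<open>The vertex \<open>v\<close> stands for the image of a codeword under \<open>x\<close>,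
  when this image lies outside \<open>C\<close>. The assumptions no longer mention
  \<open>x\<close>.\<close>

locale uncovered_vertex =
  fixes m :: nat and Q :: "'a set" and C :: "(nat \<Rightarrow> 'a) set" and v :: "nat \<Rightarrow> 'a"
  assumes finite_Q: "finite Q"
    and C_sub: "C \<subseteq> tuples m Q"
    and dist: "\<And>\<alpha> \<beta>. \<alpha> \<in> C \<Longrightarrow> \<beta> \<in> C \<Longrightarrow> \<alpha> \<noteq> \<beta> \<Longrightarrow> 3 \<le> hdist m \<alpha> \<beta>"
    and v: "v \<in> tuples m Q" "v \<notin> C" "v \<notin> code_neighbours m Q C"
    and nbrs: "vertex_neighbours m Q v \<subseteq> code_neighbours m Q C"
begin

text \<open>The path through \<gamma> bounds the distance from \<open>v\<close> to \<alpha> by 2.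
  Distances 0 and 1 would put \<open>v\<close> into \<open>C\<close> or among the neighbours of
  \<open>C\<close>.\<close>

lemma neighbour_covered:
  assumes "\<gamma> \<in> vertex_neighbours m Q v"
  obtains \<alpha> where "\<alpha> \<in> C" "hdist m v \<alpha> = 2" "\<gamma> \<in> vertex_neighbours m Q \<alpha>"
proof -
  obtain \<alpha> where \<alpha>: "\<alpha> \<in> C" "\<gamma> \<in> vertex_neighbours m Q \<alpha>"
    using assms nbrs unfolding code_neighbours_def by auto
  have "hdist m v \<alpha> \<le> hdist m v \<gamma> + hdist m \<gamma> \<alpha>" by (rule hdist_triangle)
  also have "\<dots> = 2"
    using assms \<alpha>(2) by (simp add: vertex_neighbours_iff hdist_commute[of m \<gamma>])
  finally have "hdist m v \<alpha> \<le> 2" .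
  moreover have "hdist m v \<alpha> \<noteq> 0"
    using \<alpha>(1) C_sub v hdist_eq_0_iff by blast
  moreover have "hdist m v \<alpha> \<noteq> 1"
    using \<alpha>(1) v hdist_commute[of m v \<alpha>]
    by (auto simp: code_neighbours_def vertex_neighbours_iff)
  ultimately show thesis using \<alpha> that[of \<alpha>] by linarith
qed

text \<open>Distinct codewords are at distance at least 3, so their neighbourhoods are disjoint. The
  codewords at distance 2 from \<open>v\<close> therefore partition its neighbours into blocks of
  size 2.\<close>

lemma even_valency: "even (m * (card Q - 1))"
proof -
  define D where "D = {\<alpha> \<in> C. hdist m v \<alpha> = 2}"
  let ?N = "vertex_neighbours m Q"
  have "finite D"
    unfolding D_def using finite_subset[OF C_sub finite_tuples[OF finite_Q]] by simp
  have finN: "finite (?N \<alpha>)" for \<alpha>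
    using finite_tuples[OF finite_Q] by (rule finite_subset[rotated]) (auto simp: vertex_neighbours_iff)
  have "?N v = (\<Union>\<alpha>\<in>D. ?N v \<inter> ?N \<alpha>)"
    using neighbour_covered unfolding D_def by blast
  moreover have "card (\<Union>\<alpha>\<in>D. ?N v \<inter> ?N \<alpha>) = (\<Sum>\<alpha>\<in>D. card (?N v \<inter> ?N \<alpha>))"
  proof (rule card_UN_disjoint)
    have "?N \<alpha> \<inter> ?N \<beta> = {}" if "\<alpha> \<in> D" "\<beta> \<in> D" "\<alpha> \<noteq> \<beta>" for \<alpha> \<beta>
    proof (rule ccontr)
      assume "?N \<alpha> \<inter> ?N \<beta> \<noteq> {}"
      then obtain \<gamma> where "hdist m \<alpha> \<gamma> = 1" "hdist m \<gamma> \<beta> = 1"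
        by (auto simp: vertex_neighbours_iff hdist_commute)
      then have "hdist m \<alpha> \<beta> \<le> 2" using hdist_triangle[of m \<alpha> \<beta> \<gamma>] by simp
      then show False using dist[of \<alpha> \<beta>] that unfolding D_def by simp
    qed
    then show "\<forall>\<alpha>\<in>D. \<forall>\<beta>\<in>D. \<alpha> \<noteq> \<beta> \<longrightarrow> ?N v \<inter> ?N \<alpha> \<inter> (?N v \<inter> ?N \<beta>) = {}"
      by blast
  qed (use \<open>finite D\<close> finN in auto)
  moreover have "(\<Sum>\<alpha>\<in>D. card (?N v \<inter> ?N \<alpha>)) = (\<Sum>\<alpha>\<in>D. 2)"
    using C_sub v by (intro sum.cong) (auto simp: D_def intro!: card_common_neighbours)
  ultimately have "card (?N v) = 2 * card D" by simp
  then show ?thesis using card_vertex_neighbours[OF v(1) finite_Q] by simp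
qed

lemma codeword_through:
  assumes "i < m" "a \<in> Q" "a \<noteq> v i"
  obtains \<alpha> j where "\<alpha> \<in> C" "\<alpha> i = a" "{l. l < m \<and> v l \<noteq> \<alpha> l} = {i, j}"
proof -
  have mem: "v(i := a) \<in> vertex_neighbours m Q v"
    using assms v(1) hdist_fun_upd[of i m v a] by (auto simp: vertex_neighbours_iff tuples_fun_upd)
  obtain \<alpha> where \<alpha>: "\<alpha> \<in> C" "hdist m v \<alpha> = 2" "v(i := a) \<in> vertex_neighbours m Q \<alpha>"
    using neighbour_covered[OF mem] by blast
  obtain k where k: "\<And>l. l < m \<Longrightarrow> l \<noteq> k \<Longrightarrow> \<alpha> l = (v(i := a)) l"
    using \<alpha>(3) hdist_1E[of m \<alpha> "v(i := a)"] by (metis vertex_neighbours_iff)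
  obtain p r where pr: "{l. l < m \<and> v l \<noteq> \<alpha> l} = {p, r}" "p \<noteq> r"
    using \<alpha>(2) unfolding hdist_def by (meson card_2_iff)
  have "p < m" "r < m" "v p \<noteq> \<alpha> p" "v r \<noteq> \<alpha> r" using pr by blast+
  \<comment> \<open>If \<open>i\<close> were neither \<open>p\<close> nor \<open>r\<close>, then
    \<alpha> would differ from \<open>v(i := a)\<close> in both of them. If \<open>k\<close> were
    \<open>i\<close>, then \<alpha> and \<open>v\<close> would differ at most in
    \<open>i\<close>.\<close>
  then have "i = p \<or> i = r" "i \<noteq> k" using k pr(2) by (metis fun_upd_other)+
  then show thesis
    using that[OF \<alpha>(1)] pr(1) k[OF assms(1)] by (metis fun_upd_same insert_commute)
qed

text \<open>Both codewords differ from \<open>v\<close> in two entries only. For q > 2 they carry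
  different new letters in the same entry 0, so at most three entries are involved. For q = 2 there
  is just one new letter, and the second codeword is taken through an entry where the first agrees
  with \<open>v\<close>.\<close>

lemma close_codewords:
  assumes "3 \<le> m" "2 \<le> card Q"
  obtains \<alpha> \<beta> where "\<alpha> \<in> C" "\<beta> \<in> C" "\<alpha> \<noteq> \<beta>" "hdist m \<alpha> \<beta> \<le> (if card Q = 2 then 4 else 3)"
proof -
  \<comment> \<open>Used with \<open>S\<close> empty for a second letter, and with
    \<open>S = {a}\<close> for a third one.\<close>
  have ne: "\<exists>a. a \<in> Q \<and> a \<noteq> v i \<and> a \<notin> S" if "card S + 1 < card Q" "finite S" for i S
  proof -
    have "card (insert (v i) S) < card Q" using that by (simp add: card_insert_if)
    then have "\<not> Q \<subseteq> insert (v i) S" using that(2) card_mono[of "insert (v i) S" Q] by auto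
    then show ?thesis by auto
  qed
  obtain a where a: "a \<in> Q" "a \<noteq> v 0" using ne[of "{}"] assms by auto
  obtain \<alpha> j where \<alpha>: "\<alpha> \<in> C" "\<alpha> 0 = a" "{l. l < m \<and> v l \<noteq> \<alpha> l} = {0, j}"
    using codeword_through[OF _ a] assms by auto
  have bound: "hdist m \<alpha> \<beta> \<le> card (S \<union> T)"
    if "{l. l < m \<and> v l \<noteq> \<alpha> l} = S" "{l. l < m \<and> v l \<noteq> \<beta> l} = T" for S T \<beta>
  proof (rule hdist_le_card)
    show "finite (S \<union> T)" using that by auto
  qed (use that in force)
  show thesis
  proof (cases "card Q = 2")
    case True
    \<comment> \<open>Since m \<ge> 3, one of the entries 1 and 2 is available.\<close>
    obtain k where k: "k < m" "k \<noteq> 0" "k \<noteq> j"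
    proof (cases "j = 1")
      case True
      then show thesis using that[of 2] assms(1) by simp
    next
      case False
      then show thesis using that[of 1] assms(1) by simp
    qed
    obtain b where b: "b \<in> Q" "b \<noteq> v k" using ne[of "{}"] assms by auto
    obtain \<beta> l where \<beta>: "\<beta> \<in> C" "\<beta> k = b" "{i. i < m \<and> v i \<noteq> \<beta> i} = {k, l}"
      using codeword_through[OF k(1) b] by auto
    have "k \<notin> {l. l < m \<and> v l \<noteq> \<alpha> l}" unfolding \<alpha>(3) using k by simp
    then have "\<alpha> \<noteq> \<beta>" using k(1) b(2) \<beta>(2) by auto
    moreover have "hdist m \<alpha> \<beta> \<le> card ({0, j} \<union> {k, l})"
      by (rule bound[OF \<alpha>(3) \<beta>(3)])
    moreover have "card ({0, j} \<union> {k, l}) \<le> 4"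
      by (simp add: card_insert_if)
    ultimately show thesis using that[of \<alpha> \<beta>] \<alpha>(1) \<beta>(1) True by auto
  next
    case False
    then obtain b where b: "b \<in> Q" "b \<noteq> v 0" "b \<noteq> a" using ne[of "{a}" 0] assms by auto
    obtain \<beta> l where \<beta>: "\<beta> \<in> C" "\<beta> 0 = b" "{i. i < m \<and> v i \<noteq> \<beta> i} = {0, l}"
      using codeword_through[OF _ b(1,2)] assms by auto
    have "\<alpha> \<noteq> \<beta>" using \<alpha>(2) \<beta>(2) b by auto
    moreover have "hdist m \<alpha> \<beta> \<le> card ({0, j} \<union> {0, l})"
      by (rule bound[OF \<alpha>(3) \<beta>(3)])
    moreover have "card ({0, j} \<union> {0, l}) \<le> 3"
      by (simp add: card_insert_if)
    ultimately show thesis using that[of \<alpha> \<beta>] \<alpha>(1) \<beta>(1) False by auto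
  qed
qed

end

text \<open>A codeword \<open>c\<close> is neither a neighbour of \<open>C\<close> nor adjacent to
  another codeword. The automorphism \<open>x\<close> carries these properties to \<open>x c\<close>
  while preserving the set of neighbours, so \<open>x c\<close> is an uncovered vertex as soon as it
  leaves \<open>C\<close>.\<close>

lemma aut_fixing_neighbours:
  fixes C :: "(nat \<Rightarrow> 'a) set"
  assumes Q: "finite Q" and C: "C \<subseteq> tuples m Q" "2 \<le> card C" "3 \<le> min_distance m C"
    and x: "x \<in> graph_aut (hamming_graph m Q)"
    and fixN: "fixes_setwise x (code_neighbours m Q C)"
    and notC: "\<not> fixes_setwise x C"
  shows "(min_distance m C = 4 \<and> card Q = 2 \<and> even m) \<or>
    (min_distance m C = 3 \<and> even (m * (card Q - 1)))"
proof -
  have finC: "finite C" using C(1) finite_tuples[OF Q] finite_subset by blast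
  have bij: "bij_betw x (tuples m Q) (tuples m Q)"
    and adj: "\<And>u w. u \<in> tuples m Q \<Longrightarrow> w \<in> tuples m Q \<Longrightarrow> hdist m u w = 1 \<longleftrightarrow> hdist m (x u) (x w) = 1"
    using x unfolding graph_aut_def Bij_def by (auto simp: bij_betw_apply)
  have inj: "inj_on x (tuples m Q)" using bij by (simp add: bij_betw_def)
  \<comment> \<open>An injective map of a finite set into itself is onto, so an inclusion would
    already fix \<open>C\<close> setwise.\<close>
  have "\<not> x ` C \<subseteq> C"
    using notC endo_inj_surj[OF finC _ inj_on_subset[OF inj C(1)]] unfolding fixes_setwise_def by blast
  then obtain c where c: "c \<in> C" "x c \<notin> C" by auto
  have dist: "3 \<le> hdist m \<alpha> \<beta>" if "\<alpha> \<in> C" "\<beta> \<in> C" "\<alpha> \<noteq> \<beta>" for \<alpha> \<beta>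
    using min_distance_le[OF finC that] C(3) by (rule le_trans[rotated])
  have ct: "c \<in> tuples m Q" using c C by auto
  have xt: "x u \<in> tuples m Q" if "u \<in> tuples m Q" for u using bij that by (rule bij_betw_apply)
  interpret uncovered_vertex m Q C "x c"
  proof
    show "x c \<in> tuples m Q" using ct by (rule xt)
    show "x c \<notin> code_neighbours m Q C"
    proof
      assume "x c \<in> code_neighbours m Q C"
      then obtain w where w: "w \<in> code_neighbours m Q C" "x w = x c"
        using fixN unfolding fixes_setwise_def by (metis imageE)
      then have "w \<in> tuples m Q" unfolding code_neighbours_def by (auto simp: vertex_neighbours_iff)
      then have "w = c" using w(2) ct inj by (auto dest: inj_onD)
      then show False using w(1) c unfolding code_neighbours_def by simp
    qed
    show "vertex_neighbours m Q (x c) \<subseteq> code_neighbours m Q C"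
    proof
      fix \<gamma> assume \<gamma>: "\<gamma> \<in> vertex_neighbours m Q (x c)"
      then obtain w where w: "w \<in> tuples m Q" "\<gamma> = x w"
        using bij unfolding vertex_neighbours_iff bij_betw_def by auto
      then have "hdist m c w = 1" using adj ct \<gamma> by (auto simp: vertex_neighbours_iff)
      \<comment> \<open>A codeword other than \<open>c\<close> is at distance at least 3 from
        \<open>c\<close>.\<close>
      moreover from this have "w \<notin> C" using dist[of c w] c by (cases "c = w") (auto simp: hdist_def)
      ultimately have "w \<in> code_neighbours m Q C"
        using c w by (auto simp: code_neighbours_def vertex_neighbours_iff)
      then show "\<gamma> \<in> code_neighbours m Q C"
        using fixN w(2) unfolding fixes_setwise_def by auto
    qed
  qed (use Q C dist c in auto)
  \<comment> \<open>Two distinct codewords force m \<ge> 3 and q \<ge> 2, as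
    \<open>close_codewords\<close> requires.\<close>
  obtain \<alpha> \<beta> where ab: "\<alpha> \<in> C" "\<beta> \<in> C" "\<alpha> \<noteq> \<beta>"
    using C(2) by (metis card_2_iff' card_le_Suc0_iff_eq finC not_less_eq_eq numeral_2_eq_2)
  have "hdist m \<alpha> \<beta> \<le> card {..<m}" by (rule hdist_le_card) auto
  then have m: "3 \<le> m" using dist[OF ab] by simp
  obtain i where "i < m" "\<alpha> i \<noteq> \<beta> i" using ab C(1) tuples_eqI by (metis subsetD)
  then have "{\<alpha> i, \<beta> i} \<subseteq> Q" "card {\<alpha> i, \<beta> i} = 2"
    using ab C(1) by (auto simp: tuples_mem subset_eq)
  then have q: "2 \<le> card Q" using card_mono[OF Q] by metis
  obtain \<alpha> \<beta> where "\<alpha> \<in> C" "\<beta> \<in> C" "\<alpha> \<noteq> \<beta>" "hdist m \<alpha> \<beta> \<le> (if card Q = 2 then 4 else 3)"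
    using close_codewords[OF m q] by blast
  then have "min_distance m C \<le> (if card Q = 2 then 4 else 3)"
    using min_distance_le[OF finC] le_trans by blast
  \<comment> \<open>The minimum distance is 3, or it is 4 with q = 2; in the latter case m(q - 1) is
    m itself.\<close>
  then show ?thesis using even_valency C(3) by (auto split: if_splits)
qed


section \<open>Automorphism groups and setwise stabilizers\<close>

lemma subgroup_BijGroupI:
  assumes "X \<subseteq> Bij S" "(\<lambda>s\<in>S. s) \<in> X"
    and "\<And>x y. x \<in> X \<Longrightarrow> y \<in> X \<Longrightarrow> compose S x y \<in> X"
    and "\<And>x. x \<in> X \<Longrightarrow> restrict (inv_into S x) S \<in> X"
  shows "subgroup X (BijGroup S)"
proof (rule group.subgroupI[OF group_BijGroup])
  show "X \<subseteq> carrier (BijGroup S)" using assms(1) by (simp add: BijGroup_def)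
  show "X \<noteq> {}" using assms(2) by auto
  fix x assume x: "x \<in> X"
  then show "inv\<^bsub>BijGroup S\<^esub> x \<in> X" using assms(1,4) by (simp add: inv_BijGroup subsetD)
  fix y assume "y \<in> X"
  then show "x \<otimes>\<^bsub>BijGroup S\<^esub> y \<in> X" using x assms(1,3) by (auto simp: BijGroup_def subsetD)
qed

lemma subgroup_graph_aut: "subgroup (graph_aut G) (BijGroup (pverts G))"
proof (rule subgroup_BijGroupI)
  fix x assume x: "x \<in> graph_aut G"
  then have xB: "x \<in> Bij (pverts G)" by (simp add: graph_aut_def)
  then have "x ` pverts G = pverts G" by (simp add: Bij_def bij_betw_def)
  then have "x (inv_into (pverts G) x v) = v" if "v \<in> pverts G" for v
    using that by (simp add: f_inv_into_f)
  with x xB Bij_inv_into_mem[OF xB] show "restrict (inv_into (pverts G) x) (pverts G) \<in> graph_aut G"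
    by (auto simp: graph_aut_def restrict_inv_into_Bij)
next
  fix x y assume x: "x \<in> graph_aut G" and y: "y \<in> graph_aut G"
  then have "y u \<in> pverts G" if "u \<in> pverts G" for u
    using that by (auto simp: graph_aut_def dest: Bij_imp_funcset[THEN funcset_mem])
  then show "compose (pverts G) x y \<in> graph_aut G"
    using x y by (simp add: graph_aut_def compose_Bij compose_eq)
qed (auto simp: graph_aut_def id_Bij)

text \<open>Provides the group X of the second claim. With the full stabilizer, transitivity reduces
  to exhibiting one suitable automorphism for each pair of neighbours.\<close>

definition setwise_stabilizer :: "'v pair_pre_digraph \<Rightarrow> 'v set \<Rightarrow> ('v \<Rightarrow> 'v) set" where
  "setwise_stabilizer G S = {x \<in> graph_aut G. fixes_setwise x S}"

context
  fixes G :: "'v pair_pre_digraph" and S :: "'v set"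
  assumes S: "S \<subseteq> pverts G"
begin

lemma subgroup_setwise_stabilizer_Bij: "subgroup (setwise_stabilizer G S) (BijGroup (pverts G))"
proof (rule subgroup_BijGroupI)
  note sub = subgroup_graph_aut[of G]
  show "setwise_stabilizer G S \<subseteq> Bij (pverts G)"
    by (auto simp: setwise_stabilizer_def graph_aut_def)
  show "(\<lambda>s\<in>pverts G. s) \<in> setwise_stabilizer G S"
    using S subgroup.one_closed[OF sub]
    by (auto simp: setwise_stabilizer_def fixes_setwise_def BijGroup_def subsetD)
  fix x assume x: "x \<in> setwise_stabilizer G S"
  then have xB: "x \<in> Bij (pverts G)" "x \<in> graph_aut G" "x ` S = S"
    by (auto simp: setwise_stabilizer_def graph_aut_def fixes_setwise_def)
  have "inv_into (pverts G) x ` S = S"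
    using xB S by (metis Bij_def IntD2 bij_betw_def inv_into_image_cancel mem_Collect_eq)
  moreover have "restrict (inv_into (pverts G) x) (pverts G) ` S = inv_into (pverts G) x ` S"
    using S by (intro image_cong) auto
  moreover have "restrict (inv_into (pverts G) x) (pverts G) \<in> graph_aut G"
    using subgroup.m_inv_closed[OF sub xB(2)] xB(1) by (simp add: inv_BijGroup)
  ultimately show "restrict (inv_into (pverts G) x) (pverts G) \<in> setwise_stabilizer G S"
    by (simp add: setwise_stabilizer_def fixes_setwise_def)
  fix y assume y: "y \<in> setwise_stabilizer G S"
  then have yB: "y \<in> Bij (pverts G)" "y \<in> graph_aut G" "y ` S = S"
    by (auto simp: setwise_stabilizer_def graph_aut_def fixes_setwise_def)
  have "compose (pverts G) x y ` S = x ` y ` S"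
    using S by (force simp: compose_def)
  moreover have "compose (pverts G) x y \<in> graph_aut G"
    using subgroup.m_closed[OF sub xB(2) yB(2)] xB(1) yB(1) by (simp add: BijGroup_def)
  ultimately show "compose (pverts G) x y \<in> setwise_stabilizer G S"
    using xB yB by (simp add: setwise_stabilizer_def fixes_setwise_def)
qed

lemma subgroup_setwise_stabilizer: "subgroup (setwise_stabilizer G S) (graph_aut_group G)"
  unfolding graph_aut_group_def
  by (intro group.subgroup_incl[OF group_BijGroup] subgroup_setwise_stabilizer_Bij subgroup_graph_aut)
     (auto simp: setwise_stabilizer_def)

text \<open>Restriction to \<open>S\<close> is multiplicative because every member of the stabilizer
  maps \<open>S\<close> onto itself.\<close>

lemma setwise_stabilizer_action:
  "group_action (graph_aut_group G \<lparr>carrier := setwise_stabilizer G S\<rparr>) S (\<lambda>x. restrict x S)"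
proof -
  let ?X = "setwise_stabilizer G S"
  have eq: "graph_aut_group G \<lparr>carrier := ?X\<rparr> = BijGroup (pverts G) \<lparr>carrier := ?X\<rparr>"
    by (simp add: graph_aut_group_def)
  have X: "x \<in> Bij (pverts G)" "x ` S = S" if "x \<in> ?X" for x
    using that by (auto simp: setwise_stabilizer_def graph_aut_def fixes_setwise_def)
  have Bij_S: "restrict x S \<in> Bij S" if "x \<in> ?X" for x
    using X[OF that] S by (auto simp: Bij_def bij_betw_def intro: inj_on_subset)
  have hom: "(\<lambda>x. restrict x S) \<in> hom (BijGroup (pverts G) \<lparr>carrier := ?X\<rparr>) (BijGroup S)"
  proof (rule homI)
    fix x y assume "x \<in> carrier (BijGroup (pverts G)\<lparr>carrier := ?X\<rparr>)"
      "y \<in> carrier (BijGroup (pverts G)\<lparr>carrier := ?X\<rparr>)"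
    then have xy: "x \<in> ?X" "y \<in> ?X" by auto
    have "restrict (compose (pverts G) x y) S = compose S (restrict x S) (restrict y S)"
      using S X(2)[OF xy(2)] by (auto simp: compose_def restrict_def fun_eq_iff)
    then show "restrict (x \<otimes>\<^bsub>BijGroup (pverts G)\<lparr>carrier := ?X\<rparr>\<^esub> y) S =
        restrict x S \<otimes>\<^bsub>BijGroup S\<^esub> restrict y S"
      using X(1)[OF xy(1)] X(1)[OF xy(2)] Bij_S[OF xy(1)] Bij_S[OF xy(2)] by (simp add: BijGroup_def)
  qed (use Bij_S in \<open>simp add: BijGroup_def\<close>)
  show ?thesis
    unfolding eq
    by (intro group_action.intro group_hom.intro group_hom_axioms.intro hom group_BijGroup
        group.subgroup_imp_group[OF group_BijGroup] subgroup_setwise_stabilizer_Bij)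
qed

end

text \<open>Such a map preserves the Hamming distance. Injectivity follows because distance 0 means
  equality, and surjectivity because there are finitely many tuples.\<close>

lemma coordinate_map_graph_aut:
  assumes "finite Q" and \<pi>: "bij_betw \<pi> {..<m} {..<m}" and \<sigma>: "\<And>i. i < m \<Longrightarrow> bij_betw (\<sigma> i) Q Q"
  shows "(\<lambda>f\<in>tuples m Q. \<lambda>i\<in>{..<m}. \<sigma> i (f (\<pi> i))) \<in> graph_aut (hamming_graph m Q)"
    (is "?x \<in> _")
proof -
  have closed: "?x f \<in> tuples m Q" if "f \<in> tuples m Q" for f
  proof -
    have "\<sigma> i (f (\<pi> i)) \<in> Q" if "i < m" for i
      using bij_betw_apply[OF \<sigma>[OF that]] bij_betw_apply[OF \<pi>, of i] that tuples_mem[OF \<open>f \<in> _\<close>] by simp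
    then show ?thesis using that by (auto simp: tuples_def)
  qed
  have isometry: "hdist m (?x f) (?x g) = hdist m f g" if "f \<in> tuples m Q" "g \<in> tuples m Q" for f g
  proof -
    have "\<sigma> i (f (\<pi> i)) \<noteq> \<sigma> i (g (\<pi> i)) \<longleftrightarrow> f (\<pi> i) \<noteq> g (\<pi> i)" if "i < m" for i
      using \<sigma>[OF that] tuples_mem[OF \<open>f \<in> _\<close>] tuples_mem[OF \<open>g \<in> _\<close>] bij_betw_apply[OF \<pi>, of i] that
      by (auto simp: bij_betw_def inj_on_eq_iff)
    then have "{i. i < m \<and> ?x f i \<noteq> ?x g i} = {i. i < m \<and> f (\<pi> i) \<noteq> g (\<pi> i)}"
      using that by auto
    \<comment> \<open>The permutation carries the entries where the images differ to those where
      \<open>f\<close> and \<open>g\<close> differ.\<close>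
    moreover have "\<pi> ` {i. i < m \<and> f (\<pi> i) \<noteq> g (\<pi> i)} = {i \<in> \<pi> ` {..<m}. f i \<noteq> g i}"
      by auto
    moreover have "\<pi> ` {..<m} = {..<m}" using \<pi> by (simp add: bij_betw_def)
    moreover have "inj_on \<pi> {i. i < m \<and> f (\<pi> i) \<noteq> g (\<pi> i)}"
      using \<pi> by (auto simp: bij_betw_def intro: inj_on_subset)
    ultimately show ?thesis
      unfolding hdist_def using card_image[of \<pi> "{i. i < m \<and> f (\<pi> i) \<noteq> g (\<pi> i)}"] by simp
  qed
  have inj: "inj_on ?x (tuples m Q)"
  proof (rule inj_onI)
    fix f g assume fg: "f \<in> tuples m Q" "g \<in> tuples m Q" and eq: "?x f = ?x g"
    have "hdist m (?x f) (?x g) = 0"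
      unfolding eq by (simp only: hdist_eq_0_iff[OF closed[OF fg(2)] closed[OF fg(2)]])
    then show "f = g" unfolding isometry[OF fg] hdist_eq_0_iff[OF fg] .
  qed
  have "?x ` tuples m Q \<subseteq> tuples m Q" using closed by (rule image_subsetI)
  then have "?x ` tuples m Q = tuples m Q"
    using finite_tuples[OF assms(1)] inj by (intro endo_inj_surj)
  with inj have "bij_betw ?x (tuples m Q) (tuples m Q)" by (rule bij_betw_imageI)
  then have "?x \<in> Bij (tuples m Q)"
    by (simp add: Bij_def)
  moreover have "(f, g) \<in> parcs (hamming_graph m Q) \<longleftrightarrow> (?x f, ?x g) \<in> parcs (hamming_graph m Q)"
    if "f \<in> tuples m Q" "g \<in> tuples m Q" for f g
    unfolding parcs_hamming_graph isometry[OF that] using that closed[OF that(1)] closed[OF that(2)] by simp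
  ultimately show ?thesis
    unfolding graph_aut_def pverts_hamming_graph by blast
qed

section \<open>The code of doubled words of odd weight\<close>

locale doubled_words =
  fixes k :: nat and a b :: 'a
  assumes k: "2 \<le> k" and ab: "a \<noteq> b"
begin

definition unequal :: "(nat \<Rightarrow> 'a) \<Rightarrow> nat set" where
  "unequal f = {p. p < k \<and> f (2 * p) \<noteq> f (2 * p + 1)}"

text \<open>Reading the first entry of a pair is enough: on words without mixed pairs this yields
  the pairs \<open>bb\<close>.\<close>

definition ones :: "(nat \<Rightarrow> 'a) \<Rightarrow> nat set" where
  "ones f = {p. p < k \<and> f (2 * p) = b}"

abbreviation "words \<equiv> tuples (2 * k) {a, b}"

lemma words_mem:
  assumes "f \<in> words" "p < k"
  shows "f (2 * p) \<in> {a, b}" "f (2 * p + 1) \<in> {a, b}"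
  using assms(2) by (auto intro!: tuples_mem[OF assms(1)] simp del: insert_iff)

lemma unequal_singletonD:
  assumes "unequal f = {p}"
  shows "p < k" "f (2 * p) \<noteq> f (2 * p + 1)"
    and "\<And>r. r < k \<Longrightarrow> r \<noteq> p \<Longrightarrow> f (2 * r + 1) = f (2 * r)"
proof -
  have "r < k \<and> f (2 * r) \<noteq> f (2 * r + 1) \<longleftrightarrow> r = p" for r
    using assms unfolding unequal_def set_eq_iff by simp
  then show "p < k" "f (2 * p) \<noteq> f (2 * p + 1)"
    and "\<And>r. r < k \<Longrightarrow> r \<noteq> p \<Longrightarrow> f (2 * r + 1) = f (2 * r)"
    by metis+
qed

text \<open>With \<open>a\<close> and \<open>b\<close> read as 0 and 1, these are the binary words
  of length \<open>k\<close> and odd weight with every letter written twice.\<close>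

definition odd_code :: "(nat \<Rightarrow> 'a) set" where
  "odd_code = {f \<in> words. unequal f = {} \<and> odd (card (ones f))}"

lemma finite_ones: "finite (ones f)"
  by (simp add: ones_def)

lemma pair_cases:
  assumes "i < 2 * k"
  obtains p where "p < k" "i = 2 * p" | p where "p < k" "i = 2 * p + 1"
  using assms by (cases "even i") (auto elim!: evenE oddE)

text \<open>Exactly one index, \<open>p\<close>, enters or leaves the set.\<close>

lemma odd_card_ones_differ:
  assumes "p < k" and "f (2 * p) = b \<longleftrightarrow> g (2 * p) \<noteq> b"
    and "\<And>r. r < k \<Longrightarrow> r \<noteq> p \<Longrightarrow> f (2 * r) = b \<longleftrightarrow> g (2 * r) = b"
  shows "odd (card (ones f)) \<longleftrightarrow> even (card (ones g))"
proof (cases "f (2 * p) = b")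
  case True
  then have "ones f = insert p (ones g)" "p \<notin> ones g"
    using assms unfolding ones_def by auto
  then show ?thesis using finite_ones[of g] by simp
next
  case False
  then have "ones g = insert p (ones f)" "p \<notin> ones f"
    using assms unfolding ones_def by auto
  then show ?thesis using finite_ones[of f] by simp
qed

text \<open>One change in a doubled word spoils exactly one pair. Conversely, a single mixed pair
  can be levelled in two ways, and the results have opposite parities, so one of them is a
  codeword.\<close>

lemma code_neighbours_odd_code:
  "code_neighbours (2 * k) {a, b} odd_code = {f \<in> words. card (unequal f) = 1}" (is "?L = ?R")
proof (intro equalityI subsetI)
  fix f assume "f \<in> ?L"
  then obtain \<alpha> where \<alpha>: "\<alpha> \<in> words" "unequal \<alpha> = {}" and f: "f \<in> words" "hdist (2 * k) \<alpha> f = 1"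
    by (auto simp: code_neighbours_def vertex_neighbours_iff odd_code_def)
  obtain i where i: "i < 2 * k" "\<alpha> i \<noteq> f i" "\<And>j. j < 2 * k \<Longrightarrow> j \<noteq> i \<Longrightarrow> \<alpha> j = f j"
    using hdist_1E[OF f(2)] by metis
  have eq: "\<alpha> (2 * p) = \<alpha> (2 * p + 1)" if "p < k" for p
    using \<alpha>(2) that unfolding unequal_def by auto
  \<comment> \<open>The changed entry \<open>i\<close> lies in the pair \<open>i div 2\<close>; all
    other pairs are untouched.\<close>
  have "p \<in> unequal f \<longleftrightarrow> p = i div 2" if "p < k" for p
  proof (cases "i = 2 * p \<or> i = 2 * p + 1")
    case True
    then show ?thesis using i eq[OF that] that i(3)[of "2 * p"] i(3)[of "2 * p + 1"]
      unfolding unequal_def by auto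
  next
    case False
    then have "p \<noteq> i div 2" by presburger
    then show ?thesis using False i(3)[of "2 * p"] i(3)[of "2 * p + 1"] that eq[OF that]
      unfolding unequal_def by auto
  qed
  moreover have "i div 2 < k" using i(1) by auto
  ultimately have "unequal f = {i div 2}" unfolding unequal_def by blast
  then show "f \<in> ?R" using f by simp
next
  fix f assume "f \<in> ?R"
  then obtain p where f: "f \<in> words" and p: "unequal f = {p}"
    by (auto simp: card_1_singleton_iff)
  note pk = unequal_singletonD(1,2)[OF p] and eq = unequal_singletonD(3)[OF p]
  have mem: "f (2 * p) \<in> {a, b}" "f (2 * p + 1) \<in> {a, b}"
    using words_mem[OF f pk(1)] by auto
  have "f \<notin> odd_code" using p by (simp add: odd_code_def)
  \<comment> \<open>The two ways to level the mixed pair: copy its second letter to the first entry,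
    or its first letter to the second.\<close>
  define \<alpha> where "\<alpha> = f(2 * p := f (2 * p + 1))"
  define \<beta> where "\<beta> = f(2 * p + 1 := f (2 * p))"
  have words: "\<alpha> \<in> words" "\<beta> \<in> words"
    unfolding \<alpha>_def \<beta>_def using f mem pk(1) by (auto intro!: tuples_fun_upd)
  have unequal: "unequal \<alpha> = {}" "unequal \<beta> = {}"
  proof -
    have "\<alpha> (2 * r) = \<alpha> (2 * r + 1)" "\<beta> (2 * r) = \<beta> (2 * r + 1)" if "r < k" for r
    proof -
      have "2 * r + 1 \<noteq> 2 * p" "2 * r \<noteq> 2 * p + 1" by presburger+
      then show "\<alpha> (2 * r) = \<alpha> (2 * r + 1)" "\<beta> (2 * r) = \<beta> (2 * r + 1)"
        using eq[OF that] by (auto simp: \<alpha>_def \<beta>_def)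
    qed
    then show "unequal \<alpha> = {}" "unequal \<beta> = {}" unfolding unequal_def by auto
  qed
  have hdist: "hdist (2 * k) \<alpha> f = 1" "hdist (2 * k) \<beta> f = 1"
    unfolding \<alpha>_def \<beta>_def hdist_commute[of _ _ f] using pk by (auto intro!: hdist_fun_upd simp del: One_nat_def)
  have "odd (card (ones \<alpha>)) \<longleftrightarrow> even (card (ones \<beta>))"
    using pk mem ab by (intro odd_card_ones_differ[of p]) (auto simp: \<alpha>_def \<beta>_def)
  then have "\<alpha> \<in> odd_code \<or> \<beta> \<in> odd_code"
    using words unequal by (auto simp: odd_code_def)
  then show "f \<in> ?L"
    using f hdist \<open>f \<notin> odd_code\<close> by (auto simp: code_neighbours_def vertex_neighbours_iff)
qed

text \<open>For \<open>p < k\<close> these are the doubled words of weight one. Two of them attain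
  the distance 4, and one is later moved out of the code.\<close>

definition unit_word :: "nat \<Rightarrow> nat \<Rightarrow> 'a" where
  "unit_word p = (\<lambda>i\<in>{..<2 * k}. if i div 2 = p then b else a)"

lemma unit_word_in_odd_code: "p < k \<Longrightarrow> unit_word p \<in> odd_code"
proof -
  assume "p < k"
  then have "ones (unit_word p) = {p}" "unequal (unit_word p) = {}"
    using ab by (auto simp: ones_def unequal_def unit_word_def)
  then show ?thesis by (auto simp: odd_code_def unit_word_def tuples_def)
qed

lemma unit_word_neq: "unit_word 0 \<noteq> unit_word 1"
proof -
  have "unit_word 0 0 \<noteq> unit_word 1 0" using k ab by (simp add: unit_word_def)
  then show ?thesis by metis
qed

text \<open>Distinct codewords differ in some pair, equal parity forces a second such pair, and each
  of these contributes two entries.\<close>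

lemma odd_code_distance:
  assumes f: "f \<in> odd_code" and g: "g \<in> odd_code" and "f \<noteq> g"
  shows "4 \<le> hdist (2 * k) f g"
proof -
  have fg: "f (2 * p + 1) = f (2 * p)" "g (2 * p + 1) = g (2 * p)" if "p < k" for p
    using f g that unfolding odd_code_def unequal_def by auto
  have ex: "\<exists>p<k. f (2 * p) \<noteq> g (2 * p)"
  proof (rule ccontr)
    assume contr: "\<not> ?thesis"
    have "f i = g i" if "i < 2 * k" for i
      using that by (cases rule: pair_cases) (use contr fg in auto)
    then have "f = g" using f g unfolding odd_code_def by (auto intro: tuples_eqI)
    then show False using assms(3) by simp
  qed
  then obtain p where p: "p < k" "f (2 * p) \<noteq> g (2 * p)" by blast
  have "f (2 * p) \<in> {a, b}" "g (2 * p) \<in> {a, b}"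
    using f g words_mem(1)[OF _ p(1)] unfolding odd_code_def by blast+
  then have pb: "f (2 * p) = b \<longleftrightarrow> g (2 * p) \<noteq> b" using p(2) by auto
  have "\<exists>r<k. r \<noteq> p \<and> f (2 * r) \<noteq> g (2 * r)"
  proof (rule ccontr)
    assume "\<not> ?thesis"
    then have "odd (card (ones f)) \<longleftrightarrow> even (card (ones g))"
      using p(1) pb by (intro odd_card_ones_differ[of p]) auto
    then show False using f g unfolding odd_code_def by auto
  qed
  then obtain r where r: "r < k" "r \<noteq> p" "f (2 * r) \<noteq> g (2 * r)" by blast
  have "card {2 * p, 2 * p + 1, 2 * r, 2 * r + 1} = 4"
  proof -
    have "2 * p \<noteq> 2 * r + 1" "2 * r \<noteq> 2 * p + 1" by presburger+
    then show ?thesis using r(2) by simp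
  qed
  moreover have "card {2 * p, 2 * p + 1, 2 * r, 2 * r + 1} \<le> hdist (2 * k) f g"
    using p r fg by (intro hdist_ge_card) auto
  ultimately show ?thesis by simp
qed

lemma finite_odd_code: "finite odd_code"
  unfolding odd_code_def using finite_tuples[of "{a, b}"] by simp

lemma min_distance_odd_code: "min_distance (2 * k) odd_code = 4"
  unfolding min_distance_def
proof (rule Min_eqI)
  show "finite {hdist (2 * k) \<alpha> \<beta> |\<alpha> \<beta>. \<alpha> \<in> odd_code \<and> \<beta> \<in> odd_code \<and> \<alpha> \<noteq> \<beta>}"
    by (rule finite_distances[OF finite_odd_code])
  have units: "unit_word 0 \<in> odd_code" "unit_word 1 \<in> odd_code"
    using k by (auto intro: unit_word_in_odd_code)
  \<comment> \<open>The two words differ only inside pairs 0 and 1, that is, in entries 0 to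
    3.\<close>
  have "hdist (2 * k) (unit_word 0) (unit_word 1) \<le> card {..<4::nat}"
    by (rule hdist_le_card) (auto simp: unit_word_def split: if_splits)
  then have "hdist (2 * k) (unit_word 0) (unit_word 1) = 4"
    using odd_code_distance[OF units unit_word_neq] by simp
  then show "4 \<in> {hdist (2 * k) \<alpha> \<beta> |\<alpha> \<beta>. \<alpha> \<in> odd_code \<and> \<beta> \<in> odd_code \<and> \<alpha> \<noteq> \<beta>}"
    using units unit_word_neq by force
qed (use odd_code_distance in auto)

text \<open>Pairs move as a whole and both entries of a pair undergo the same letter map, so that
  mixed pairs stay mixed and constant pairs stay constant.\<close>

definition pair_map :: "(nat \<Rightarrow> nat) \<Rightarrow> (nat \<Rightarrow> 'a \<Rightarrow> 'a) \<Rightarrow> (nat \<Rightarrow> 'a) \<Rightarrow> nat \<Rightarrow> 'a" where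
  "pair_map \<tau> \<sigma> = (\<lambda>f\<in>words. \<lambda>i\<in>{..<2 * k}. \<sigma> (i div 2) (f (2 * \<tau> (i div 2) + i mod 2)))"

lemma pair_map_apply:
  assumes "f \<in> words" "p < k"
  shows "pair_map \<tau> \<sigma> f (2 * p) = \<sigma> p (f (2 * \<tau> p))"
    and "pair_map \<tau> \<sigma> f (2 * p + 1) = \<sigma> p (f (2 * \<tau> p + 1))"
  using assms by (simp_all add: pair_map_def)

text \<open>The map \<tau> is taken to be an involution, hence its own inverse; below it is the
  identity or a transposition of two pairs.\<close>

context
  fixes \<tau> :: "nat \<Rightarrow> nat" and \<sigma> :: "nat \<Rightarrow> 'a \<Rightarrow> 'a"
  assumes \<tau>: "\<And>p. p < k \<Longrightarrow> \<tau> p < k" "\<And>p. p < k \<Longrightarrow> \<tau> (\<tau> p) = p"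
    and \<sigma>: "\<And>p. p < k \<Longrightarrow> bij_betw (\<sigma> p) {a, b} {a, b}"
begin

lemma pair_map_graph_aut: "pair_map \<tau> \<sigma> \<in> graph_aut (hamming_graph (2 * k) {a, b})"
  unfolding pair_map_def
proof (rule coordinate_map_graph_aut)
  let ?\<pi> = "\<lambda>i. 2 * \<tau> (i div 2) + i mod 2"
  have "?\<pi> i < 2 * k" "?\<pi> (?\<pi> i) = i" if "i < 2 * k" for i
  proof -
    have "i div 2 < k" using that by auto
    then have "\<tau> (i div 2) < k" "\<tau> (\<tau> (i div 2)) = i div 2" using \<tau> by auto
    then show "?\<pi> i < 2 * k" "?\<pi> (?\<pi> i) = i" by auto
  qed
  then show "bij_betw ?\<pi> {..<2 * k} {..<2 * k}"
    by (intro bij_betw_byWitness[where f' = ?\<pi>]) auto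
qed (use \<sigma> in auto)

lemma card_unequal_pair_map:
  assumes "f \<in> words"
  shows "card (unequal (pair_map \<tau> \<sigma> f)) = card (unequal f)"
proof -
  have "\<sigma> p (f (2 * \<tau> p)) \<noteq> \<sigma> p (f (2 * \<tau> p + 1)) \<longleftrightarrow> f (2 * \<tau> p) \<noteq> f (2 * \<tau> p + 1)" if "p < k" for p
  proof -
    have "f (2 * \<tau> p) \<in> {a, b}" "f (2 * \<tau> p + 1) \<in> {a, b}"
      using words_mem[OF assms \<tau>(1)[OF that]] by auto
    then show ?thesis
      using \<sigma>[OF that] inj_on_eq_iff unfolding bij_betw_def by metis
  qed
  then have "unequal (pair_map \<tau> \<sigma> f) = {p. p < k \<and> \<tau> p \<in> unequal f}"
    unfolding unequal_def using pair_map_apply[OF assms] \<tau>(1) by auto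
  also have "\<dots> = \<tau> ` unequal f"
  proof (intro equalityI subsetI)
    fix p assume "p \<in> {p. p < k \<and> \<tau> p \<in> unequal f}"
    then show "p \<in> \<tau> ` unequal f" using \<tau>(2) by (intro image_eqI[of _ _ "\<tau> p"]) auto
  next
    fix p assume "p \<in> \<tau> ` unequal f"
    then show "p \<in> {p. p < k \<and> \<tau> p \<in> unequal f}" using \<tau> by (auto simp: unequal_def)
  qed
  also have "card (\<tau> ` unequal f) = card (unequal f)"
    by (rule card_image, rule inj_on_inverseI[where g = \<tau>]) (auto simp: unequal_def \<tau>)
  finally show ?thesis .
qed

text \<open>The neighbours of the code are the words with exactly one mixed pair, a number that the
  map preserves. Finiteness and injectivity turn the inclusion into equality.\<close>

lemma pair_map_stabilizes:
  "pair_map \<tau> \<sigma> \<in> setwise_stabilizer (hamming_graph (2 * k) {a, b})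
     (code_neighbours (2 * k) {a, b} odd_code)"
proof -
  let ?N = "code_neighbours (2 * k) {a, b} odd_code"
  have bij: "bij_betw (pair_map \<tau> \<sigma>) words words"
    using pair_map_graph_aut by (simp add: graph_aut_def Bij_def)
  have "pair_map \<tau> \<sigma> ` ?N \<subseteq> ?N"
    unfolding code_neighbours_odd_code using bij_betw_apply[OF bij] card_unequal_pair_map by auto
  moreover have "?N \<subseteq> words"
    unfolding code_neighbours_odd_code by auto
  then have "finite ?N" "inj_on (pair_map \<tau> \<sigma>) ?N"
    using bij finite_subset[OF _ finite_tuples[of "{a, b}" "2 * k"]] inj_on_subset
    unfolding bij_betw_def by auto
  ultimately show ?thesis
    using pair_map_graph_aut endo_inj_surj
    unfolding setwise_stabilizer_def fixes_setwise_def by blast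
qed

end

lemma bij_betw_transpose_letters:
  "c \<in> {a, b} \<Longrightarrow> d \<in> {a, b} \<Longrightarrow> bij_betw (transpose c d) {a, b} {a, b}"
  by (rule bij_betw_byWitness[where f' = "transpose c d"]) (auto simp: transpose_def)

text \<open>On two letters, a bijection taking \<open>c\<close> to \<open>d\<close> must take the
  remaining letter to the remaining letter.\<close>

lemma transpose_other_letter:
  assumes "c \<in> {a, b}" "c' \<in> {a, b}" "d \<in> {a, b}" "d' \<in> {a, b}" "c \<noteq> c'" "d \<noteq> d'"
  shows "transpose c d c' = d'"
  using assms by (auto simp: transpose_def)

text \<open>Exchange the mixed pair of \<open>f\<close> with the position of the mixed pair of
  \<open>g\<close>, then choose the letter map of each pair so that its first entry becomes right.
  The second entries are then right as well.\<close>

lemma stabilizer_transitive: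
  assumes "f \<in> code_neighbours (2 * k) {a, b} odd_code"
    and "g \<in> code_neighbours (2 * k) {a, b} odd_code"
  shows "\<exists>x \<in> setwise_stabilizer (hamming_graph (2 * k) {a, b})
    (code_neighbours (2 * k) {a, b} odd_code). x f = g"
proof -
  obtain p r where f: "f \<in> words" "unequal f = {p}" and g: "g \<in> words" "unequal g = {r}"
    using assms unfolding code_neighbours_odd_code by (auto simp: card_1_singleton_iff)
  note pr = unequal_singletonD(1,2)[OF f(2)] unequal_singletonD(1,2)[OF g(2)]
    and f_eq = unequal_singletonD(3)[OF f(2)] and g_eq = unequal_singletonD(3)[OF g(2)]
  define \<tau> where "\<tau> = transpose p r"
  define \<sigma> where "\<sigma> s = transpose (f (2 * \<tau> s)) (g (2 * s))" for s
  have \<tau>: "\<tau> s < k" "\<tau> (\<tau> s) = s" if "s < k" for s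
    using that pr unfolding \<tau>_def by (auto simp: transpose_def)
  have fQ: "f (2 * s) \<in> {a, b}" "f (2 * s + 1) \<in> {a, b}" if "s < k" for s
    using words_mem[OF f(1) that] by auto
  have gQ: "g (2 * s) \<in> {a, b}" "g (2 * s + 1) \<in> {a, b}" if "s < k" for s
    using words_mem[OF g(1) that] by auto
  have \<sigma>: "bij_betw (\<sigma> s) {a, b} {a, b}" if "s < k" for s
    unfolding \<sigma>_def using that \<tau> fQ gQ by (intro bij_betw_transpose_letters) auto
  have stab: "pair_map \<tau> \<sigma> \<in> setwise_stabilizer (hamming_graph (2 * k) {a, b})
      (code_neighbours (2 * k) {a, b} odd_code)"
    using \<tau> \<sigma> by (rule pair_map_stabilizes)
  then have "bij_betw (pair_map \<tau> \<sigma>) words words"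
    by (simp add: setwise_stabilizer_def graph_aut_def Bij_def)
  then have img: "pair_map \<tau> \<sigma> f \<in> words" using f(1) by (rule bij_betw_apply)
  have first: "pair_map \<tau> \<sigma> f (2 * s) = g (2 * s)" if "s < k" for s
    using pair_map_apply(1)[OF f(1) that] by (simp add: \<sigma>_def)
  \<comment> \<open>In the mixed pair the second entry is the other letter, on both sides; in all
    other pairs it repeats the first.\<close>
  have second: "pair_map \<tau> \<sigma> f (2 * s + 1) = g (2 * s + 1)" if "s < k" for s
  proof (cases "s = r")
    case True
    then have "\<tau> s = p" by (simp add: \<tau>_def)
    then have "pair_map \<tau> \<sigma> f (2 * s + 1) = transpose (f (2 * p)) (g (2 * r)) (f (2 * p + 1))"
      using pair_map_apply(2)[OF f(1) that] True by (simp add: \<sigma>_def)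
    also have "\<dots> = g (2 * r + 1)"
      by (rule transpose_other_letter[OF fQ[OF pr(1)] gQ[OF pr(3)] pr(2,4)])
    finally show ?thesis using True by simp
  next
    case False
    then have "\<tau> s \<noteq> p" by (auto simp: \<tau>_def transpose_def split: if_splits)
    then show ?thesis
      using pair_map_apply(2)[OF f(1) that] f_eq[OF \<tau>(1)[OF that]] g_eq[OF that False]
      by (simp add: \<sigma>_def)
  qed
  have "pair_map \<tau> \<sigma> f = g"
  proof (rule tuples_eqI[OF img g(1)])
    fix i assume "i < 2 * k"
    then show "pair_map \<tau> \<sigma> f i = g i"
      by (cases rule: pair_cases) (simp_all only: first second)
  qed
  then show ?thesis using stab by blast
qed

text \<open>Swapping the letters in pair 0 alone turns \<open>unit_word 0\<close> into a word
  without any pair \<open>bb\<close>, which has even weight.\<close>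

lemma stabilizer_moves_odd_code:
  "\<exists>x \<in> setwise_stabilizer (hamming_graph (2 * k) {a, b})
    (code_neighbours (2 * k) {a, b} odd_code). \<not> fixes_setwise x odd_code"
proof -
  define \<sigma> where "\<sigma> p = (if p = 0 then transpose a b else id)" for p :: nat
  have \<sigma>: "bij_betw (\<sigma> p) {a, b} {a, b}" for p
    by (simp add: \<sigma>_def bij_betw_transpose_letters)
  have unit: "unit_word 0 \<in> odd_code" using k by (intro unit_word_in_odd_code) simp
  then have unit': "unit_word 0 \<in> words" by (simp add: odd_code_def)
  have "ones (pair_map id \<sigma> (unit_word 0)) = {}"
    using pair_map_apply(1)[OF unit', of _ id \<sigma>] ab
    by (auto simp: ones_def \<sigma>_def unit_word_def split: if_splits)
  then have "pair_map id \<sigma> (unit_word 0) \<notin> odd_code" by (simp add: odd_code_def)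
  then have "\<not> fixes_setwise (pair_map id \<sigma>) odd_code"
    using unit by (auto simp: fixes_setwise_def)
  then show ?thesis
    using pair_map_stabilizes[of id \<sigma>] \<sigma> by auto
qed

lemma neighbour_transitive_not_fixing:
  "\<exists>C X. C \<subseteq> pverts (hamming_graph (2 * k) {a, b}) \<and> 2 \<le> card C \<and> min_distance (2 * k) C = 4 \<and>
     subgroup X (graph_aut_group (hamming_graph (2 * k) {a, b})) \<and>
     neighbour_transitive (2 * k) {a, b} X C \<and> \<not> (\<forall>x\<in>X. fixes_setwise x C)"
proof (intro exI conjI)
  let ?G = "hamming_graph (2 * k) {a, b}" and ?N = "code_neighbours (2 * k) {a, b} odd_code"
  let ?X = "setwise_stabilizer ?G ?N"
  show "odd_code \<subseteq> pverts ?G" by (auto simp: odd_code_def)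
  have "{unit_word 0, unit_word 1} \<subseteq> odd_code"
    using k by (auto intro: unit_word_in_odd_code)
  from card_mono[OF finite_odd_code this] show "2 \<le> card odd_code"
    using unit_word_neq by simp
  show "min_distance (2 * k) odd_code = 4" by (rule min_distance_odd_code)
  have N: "?N \<subseteq> pverts ?G"
    by (auto simp: code_neighbours_def vertex_neighbours_iff)
  show "subgroup ?X (graph_aut_group ?G)"
    using N by (rule subgroup_setwise_stabilizer)
  show "neighbour_transitive (2 * k) {a, b} ?X odd_code"
    unfolding neighbour_transitive_def
  proof (intro conjI ballI transitive_action.intro transitive_action_axioms.intro
      setwise_stabilizer_action[OF N])
    show "fixes_setwise x ?N" if "x \<in> ?X" for x
      using that by (simp add: setwise_stabilizer_def)
    show "\<exists>x\<in>carrier (graph_aut_group ?G\<lparr>carrier := ?X\<rparr>). restrict x ?N f = g"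
      if "f \<in> ?N" "g \<in> ?N" for f g
      using stabilizer_transitive[OF that] that(1) by simp
  qed
  show "\<not> (\<forall>x\<in>?X. fixes_setwise x odd_code)"
    using stabilizer_moves_odd_code by blast
qed

end

theorem theorem1p2:
  shows
    "(\<forall>(m::nat) (q::nat) (Q::'a set) (C::(nat \<Rightarrow> 'a) set) (x::(nat \<Rightarrow> 'a) \<Rightarrow> (nat \<Rightarrow> 'a)).
        1 \<le> m \<and> 1 \<le> q \<and> finite Q \<and> card Q = q \<and>
        C \<subseteq> pverts (hamming_graph m Q) \<and> 2 \<le> card C \<and> 3 \<le> min_distance m C \<and>
        x \<in> carrier (graph_aut_group (hamming_graph m Q)) \<and>
        fixes_setwise x (code_neighbours m Q C) \<longrightarrow>
          fixes_setwise x C \<or>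
          (min_distance m C = 4 \<and> q = 2 \<and> even m) \<or>
          (min_distance m C = 3 \<and> even (m * (q - 1)))) \<and>
     (\<forall>(m::nat) (Q::'a set).
        4 \<le> m \<and> even m \<and> finite Q \<and> card Q = 2 \<longrightarrow>
          (\<exists>C X. C \<subseteq> pverts (hamming_graph m Q) \<and> 2 \<le> card C \<and> min_distance m C = 4 \<and>
             subgroup X (graph_aut_group (hamming_graph m Q)) \<and>
             neighbour_transitive m Q X C \<and>
             \<not> (\<forall>x\<in>X. fixes_setwise x C)))"
proof (intro conjI allI impI, goal_cases)
  case (1 m q Q C x)
  then have "x \<in> graph_aut (hamming_graph m Q)" by (simp add: graph_aut_group_def)
  then show ?case using 1 aut_fixing_neighbours[of Q C m x] by auto
next
  case (2 m Q)
  then obtain a b where Q: "Q = {a, b}" "a \<noteq> b" by (meson card_2_iff)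
  obtain k where m: "m = 2 * k" using 2 by (auto elim: evenE)
  \<comment> \<open>The bound 4 \<le> m becomes the locale assumption 2 \<le> k.\<close>
  interpret doubled_words k a b
    by unfold_locales (use 2 m Q in auto)
  show ?case unfolding m Q(1) by (rule neighbour_transitive_not_fixing)
qed

end
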